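(* Let $\alpha\in\mathbb R\setminus\{0,1\}$, let $\mathscr G_j=\{G_j: D_\alpha(G_j,F_j)\le\epsilon_j\}$, $j\in\{0,1\}$, be the $\alpha$-divergence-based uncertainty classes, and let $l=f_1/f_0$. The least favorable densities for these classes, i.e. the maximizing densities (for given $u\in(0,1)$) in the problem (P) stated in the context, are given by $$\hat g_0=\left(\frac{1-\alpha}{\lambda_0}\left(\mu_0-(1-u)\left(\frac{\hat g_1}{\hat g_0}\right)^{u}\right)+1\right)^{\frac1{\alpha-1}}f_0,$$ $$\hat g_1=\left(\frac{1-\alpha}{\lambda_1}\left(\mu_1-u\left(\frac{\hat g_1}{\hat g_0}\right)^{-1+u}\right)+1\right)^{\frac1{\alpha-1}}f_1,$$ where the robust likelihood ratio function $\hat l=\hat g_1/\hat g_0$ satisfies $$\hat l=\left(\frac{\frac{1-\alpha}{\lambda_1}\left(\mu_1-u\left(\frac{\hat g_1}{\hat g_0}\right)^{-1+u}\right)+1}{\frac{1-\alpha}{\lambda_0}\left(\mu_0-(1-u)\left(\frac{\hat g_1}{\hat g_0}\right)^{u}\right)+1}\right)^{\frac1{\alpha-1}}l.$$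
   Context: $F_0,F_1$ are the nominal probability distributions on $\Omega$ under $\mathcal H_0,\mathcal H_1$, with densities $f_0,f_1$ with respect to a dominating measure $\mu$; $g_j$ is the density of $G_j$; $\epsilon_0,\epsilon_1$ are the robustness parameters. The $\alpha$-divergence is $$D_\alpha(G_j,F_j)=\frac1{\alpha(1-\alpha)}\int_\Omega\left((1-\alpha)f_j+\alpha g_j-g_j^{\alpha}f_j^{1-\alpha}\right)d\mu.$$ The $u$-affinity is $D_u(G_0,G_1)=\int_\Omega g_1^{\,u}g_0^{\,1-u}\,d\mu$. Write $\Upsilon(G)=\int_\Omega g\,d\mu$. Problem (P): find $\hat g_0,\hat g_1$ and $\hat u$ such that $$\hat g_0=\arg\sup_{G_0\in\mathscr G_0}D_u(G_0,G_1)\ \text{ s.t. } g_0>0,\ \Upsilon(G_0)=1,\qquad \hat g_1=\arg\sup_{G_1\in\mathscr G_1}D_u(G_0,G_1)\ \text{ s.t. } g_1>0,\ \Upsilon(G_1)=1,$$ $$\hat u=\arg\min_{u\in(0,1)}D_u(\hat G_0,\hat G_1).$$ The two maximizations are coupled (in each of them the other argument is the other least favorable distribution) and are performed for the given $u$; the minimization over $u$ is then performed. The scalars $\lambda_j,\mu_j$ are the Lagrangian (KKT) multipliers in $$L_j=D_u(G_0,G_1)+\lambda_j\bigl(\epsilon_j-D_\alpha(G_j,F_j)\bigr)+\mu_j\bigl(1-\Upsilon(G_j)\bigr),\quad j\in\{0,1\}.$$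
   Formalization: The nominal densities f_0, f_1 are assumed positive a.e. (else the formulas contradict g_j>0), the robustness parameters satisfy ε_j>0, and each formula is asserted when the λ's it divides by are nonzero; λ_j=0 is shown to force g_0=g_1 a.e. *)

theory Defs
  imports "HOL-Analysis.Analysis"
begin

text \<open>
  A distribution is represented by its density with respect to the dominating measure
  \<^term>\<open>M\<close>. Densities only matter up to null sets, so pointwise requirements such as
  \<open>g > 0\<close> are imposed almost everywhere.
\<close>

definition total_mass :: "'a measure \<Rightarrow> ('a \<Rightarrow> real) \<Rightarrow> real" where
  "total_mass M g = (LINT x|M. g x)"

text \<open>
  Since the Bochner integral of a non-integrable function is \<open>0\<close>, total mass \<open>1\<close> implies
  integrability.
\<close>

definition pos_prob_density :: "'a measure \<Rightarrow> ('a \<Rightarrow> real) \<Rightarrow> bool" where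
  "pos_prob_density M g \<longleftrightarrow>
     g \<in> borel_measurable M \<and> (AE x in M. 0 < g x) \<and> total_mass M g = 1"

text \<open>
  By the weighted arithmetic-geometric mean inequality the integrand, with the factor
  \<open>1 / (\<alpha> (1 - \<alpha>))\<close> pulled inside, is nonnegative for all positive \<open>f\<close>, \<open>g\<close> and all real
  \<open>\<alpha>\<close> other than \<open>0\<close> and \<open>1\<close>. Hence the divergence is a well-defined element of
  \<open>[0, \<infinity>]\<close>; a real-valued integral would wrongly give \<open>0\<close> where it is infinite. The
  convention \<open>0 powr \<alpha> = 0\<close> is wrong for \<open>\<alpha> < 0\<close> (and for \<open>f = 0\<close>, \<open>\<alpha> > 1\<close>); it is
  irrelevant below, where both arguments are positive almost everywhere.
\<close>

definition alpha_div ::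
  "'a measure \<Rightarrow> real \<Rightarrow> ('a \<Rightarrow> real) \<Rightarrow> ('a \<Rightarrow> real) \<Rightarrow> ennreal" where
  "alpha_div M \<alpha> g f =
     (\<integral>\<^sup>+ x. ennreal (1 / (\<alpha> * (1 - \<alpha>)) *
        ((1 - \<alpha>) * f x + \<alpha> * g x - g x powr \<alpha> * f x powr (1 - \<alpha>))) \<partial>M)"

definition uncertainty_class ::
  "'a measure \<Rightarrow> real \<Rightarrow> real \<Rightarrow> ('a \<Rightarrow> real) \<Rightarrow> ('a \<Rightarrow> real) set" where
  "uncertainty_class M \<alpha> \<epsilon> f =
     {g. g \<in> borel_measurable M \<and> (AE x in M. 0 \<le> g x) \<and> alpha_div M \<alpha> g f \<le> ennreal \<epsilon>}"

definition u_affinity ::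
  "'a measure \<Rightarrow> real \<Rightarrow> ('a \<Rightarrow> real) \<Rightarrow> ('a \<Rightarrow> real) \<Rightarrow> real" where
  "u_affinity M u g0 g1 = (LINT x|M. g1 x powr u * g0 x powr (1 - u))"

definition feasible ::
  "'a measure \<Rightarrow> real \<Rightarrow> real \<Rightarrow> ('a \<Rightarrow> real) \<Rightarrow> ('a \<Rightarrow> real) \<Rightarrow> bool" where
  "feasible M \<alpha> \<epsilon> f g \<longleftrightarrow> g \<in> uncertainty_class M \<alpha> \<epsilon> f \<and> pos_prob_density M g"

definition least_favorable ::
  "'a measure \<Rightarrow> real \<Rightarrow> real \<Rightarrow> real \<Rightarrow> real \<Rightarrow> ('a \<Rightarrow> real) \<Rightarrow> ('a \<Rightarrow> real) \<Rightarrow>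
   ('a \<Rightarrow> real) \<Rightarrow> ('a \<Rightarrow> real) \<Rightarrow> bool" where
  "least_favorable M \<alpha> u \<epsilon>0 \<epsilon>1 f0 f1 g0 g1 \<longleftrightarrow>
     is_arg_max (\<lambda>g. u_affinity M u g g1) (feasible M \<alpha> \<epsilon>0 f0) g0 \<and>
     is_arg_max (\<lambda>g. u_affinity M u g0 g) (feasible M \<alpha> \<epsilon>1 f1) g1"

text \<open>
  In the Lagrangian, \<open>obj\<close> is the affinity as a function of the density that is being varied.
  The domain consists of the densities at which all terms are finite.
\<close>

definition lagrangian_domain ::
  "'a measure \<Rightarrow> real \<Rightarrow> ('a \<Rightarrow> real) \<Rightarrow> ('a \<Rightarrow> real) set" where
  "lagrangian_domain M \<alpha> f =
     {g. integrable M g \<and> (AE x in M. 0 < g x) \<and> alpha_div M \<alpha> g f < \<infinity>}"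

definition lagrangian ::
  "'a measure \<Rightarrow> real \<Rightarrow> real \<Rightarrow> ('a \<Rightarrow> real) \<Rightarrow> (('a \<Rightarrow> real) \<Rightarrow> real) \<Rightarrow>
   real \<Rightarrow> real \<Rightarrow> ('a \<Rightarrow> real) \<Rightarrow> real" where
  "lagrangian M \<alpha> \<epsilon> f obj lam mu g =
     obj g + lam * (\<epsilon> - enn2real (alpha_div M \<alpha> g f)) + mu * (1 - total_mass M g)"

text \<open>
  The Karush-Kuhn-Tucker conditions at \<open>g\<close>. Stationarity means that the Gateaux derivative
  of the Lagrangian vanishes in every direction \<open>\<psi>\<close> along which \<open>g\<close> can be moved a little
  both ways without leaving the domain.
\<close>

definition kkt_multipliers ::
  "'a measure \<Rightarrow> real \<Rightarrow> real \<Rightarrow> ('a \<Rightarrow> real) \<Rightarrow> (('a \<Rightarrow> real) \<Rightarrow> real) \<Rightarrow>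
   ('a \<Rightarrow> real) \<Rightarrow> real \<Rightarrow> real \<Rightarrow> bool" where
  "kkt_multipliers M \<alpha> \<epsilon> f obj g lam mu \<longleftrightarrow>
     feasible M \<alpha> \<epsilon> f g \<and>
     0 \<le> lam \<and>
     lam * (\<epsilon> - enn2real (alpha_div M \<alpha> g f)) = 0 \<and>
     (\<forall>\<psi> \<in> borel_measurable M.
        (\<exists>\<delta>>0. \<forall>t. \<bar>t\<bar> < \<delta> \<longrightarrow> (\<lambda>x. g x + t * \<psi> x) \<in> lagrangian_domain M \<alpha> f) \<longrightarrow>
        ((\<lambda>t. lagrangian M \<alpha> \<epsilon> f obj lam mu (\<lambda>x. g x + t * \<psi> x))
           has_real_derivative 0) (at 0))"

end

theory Submission
  imports Defs
begin

text \<open>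
  Both the \<open>\<alpha>\<close>-divergence and the negative affinity are integrals of convex functions of the
  varying density, so each maximization is a convex problem with two scalar constraints, and
  separating a convex set in \<open>\<real>\<^sup>3\<close> from the origin gives Fritz John multipliers. The nominal density
  has divergence \<open>0 < \<epsilon>\<close> and its multiples \<open>c f\<close> take the mass to both sides of \<open>1\<close>, so the multiplier of
  the objective is positive. By convexity, difference quotients of the integrands are
  dominated, and the Gateaux derivatives can be taken under the integral. Testing
  stationarity at \<open>g\<close> with \<open>\<psi> = g sgn d\<close>, where \<open>d\<close> is the derivative of the integrand, gives
  \<open>d = 0\<close> almost everywhere, which is solved for \<open>g\<close>. The second density is the first with the
  roles exchanged and \<open>u\<close> replaced by \<open>1 - u\<close>.
\<close>

section \<open>Pointwise integrands: derivatives, convexity and sign\<close>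

definition div_integrand :: "real \<Rightarrow> real \<Rightarrow> real \<Rightarrow> real" where
  "div_integrand \<alpha> a y = 1 / (\<alpha> * (1 - \<alpha>)) * ((1 - \<alpha>) * a + \<alpha> * y - y powr \<alpha> * a powr (1 - \<alpha>))"

text \<open>
  Up to an additive constant, the negative Lagrangian of a density \<open>y\<close> is the integral of the
  following integrand at \<open>nu = 1\<close>. The Fritz John multiplier \<open>nu\<close> of the objective is kept so that
  the objective and the divergence alone are instances too.
\<close>

definition lag_integrand :: "real \<Rightarrow> real \<Rightarrow> real \<Rightarrow> real \<Rightarrow> real \<Rightarrow> real \<Rightarrow> real \<Rightarrow> real \<Rightarrow> real" where
  "lag_integrand \<alpha> u nu lam mu c a y =
     lam * div_integrand \<alpha> a y + mu * y - nu * (c * y powr (1 - u))"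

definition lag_integrand_deriv ::
  "real \<Rightarrow> real \<Rightarrow> real \<Rightarrow> real \<Rightarrow> real \<Rightarrow> real \<Rightarrow> real \<Rightarrow> real \<Rightarrow> real" where
  "lag_integrand_deriv \<alpha> u nu lam mu c a y =
     lam / (1 - \<alpha>) * (1 - y powr (\<alpha> - 1) * a powr (1 - \<alpha>)) + mu - nu * (c * ((1 - u) * y powr (- u)))"

lemma lag_integrand_has_derivative:
  assumes "\<alpha> \<noteq> 0" "\<alpha> \<noteq> 1" "0 < y"
  shows "((lag_integrand \<alpha> u nu lam mu c a) has_real_derivative lag_integrand_deriv \<alpha> u nu lam mu c a y) (at y)"
proof -
  have "1 - \<alpha> \<noteq> 0" using assms by simp
  then have "lam * (1 / (\<alpha> * (1 - \<alpha>)) * (\<alpha> - \<alpha> * y powr (\<alpha> - 1) * a powr (1 - \<alpha>)))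
      = lam / (1 - \<alpha>) * (1 - y powr (\<alpha> - 1) * a powr (1 - \<alpha>))"
    using assms by (simp add: divide_simps) (simp add: algebra_simps)
  moreover have "((\<lambda>y. lam * (1 / (\<alpha> * (1 - \<alpha>)) * ((1 - \<alpha>) * a + \<alpha> * y - y powr \<alpha> * a powr (1 - \<alpha>)))
       + mu * y - nu * (c * y powr (1 - u))) has_real_derivative
      lam * (1 / (\<alpha> * (1 - \<alpha>)) * (\<alpha> - \<alpha> * y powr (\<alpha> - 1) * a powr (1 - \<alpha>))) + mu
       - nu * (c * ((1 - u) * y powr (- u)))) (at y)"
    using assms(1-3) by (auto intro!: derivative_eq_intros)
  ultimately show ?thesis
    unfolding lag_integrand_def[abs_def] div_integrand_def lag_integrand_deriv_def by simp
qed

text \<open>The factor \<open>1 / (\<alpha> * (1 - \<alpha>))\<close> cancels the constant produced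
  by differentiating \<open>- y powr \<alpha>\<close> twice, so the divergence term has a
  nonnegative second derivative whatever the signs of \<open>\<alpha>\<close> and
  \<open>1 - \<alpha>\<close>. The concave power of the objective enters with a minus sign, and the
  \<open>mu\<close> term is linear.\<close>

lemma lag_integrand_convex:
  assumes "\<alpha> \<noteq> 0" "\<alpha> \<noteq> 1" "0 < u" "u < 1" "0 \<le> nu" "0 \<le> lam" "0 \<le> c"
  shows "convex_on {0<..} (lag_integrand \<alpha> u nu lam mu c a)"
proof (rule f''_ge0_imp_convex)
  fix y :: real assume "y \<in> {0<..}"
  then have y: "0 < y" by simp
  show "((lag_integrand \<alpha> u nu lam mu c a) has_real_derivative lag_integrand_deriv \<alpha> u nu lam mu c a y) (at y)"
    by (rule lag_integrand_has_derivative) (use assms y in auto)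
  have "lam / (1 - \<alpha>) * (- ((\<alpha> - 1) * y powr (\<alpha> - 2) * a powr (1 - \<alpha>)))
      = lam * (y powr (\<alpha> - 2) * a powr (1 - \<alpha>))"
    using assms by (simp add: divide_simps) (simp add: algebra_simps)
  moreover have "((lag_integrand_deriv \<alpha> u nu lam mu c a) has_real_derivative
      lam / (1 - \<alpha>) * (- ((\<alpha> - 1) * y powr (\<alpha> - 2) * a powr (1 - \<alpha>)))
        - nu * (c * ((1 - u) * (- u * y powr (- u - 1))))) (at y)"
    unfolding lag_integrand_deriv_def[abs_def] using y assms(1,2)
    by (auto intro!: derivative_eq_intros simp: diff_diff_eq)
  ultimately show "((lag_integrand_deriv \<alpha> u nu lam mu c a) has_real_derivative
      lam * (y powr (\<alpha> - 2) * a powr (1 - \<alpha>)) + nu * (c * ((1 - u) * (u * y powr (- u - 1))))) (at y)"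
    by simp
  show "0 \<le> lam * (y powr (\<alpha> - 2) * a powr (1 - \<alpha>)) + nu * (c * ((1 - u) * (u * y powr (- u - 1))))"
    using assms by (intro add_nonneg_nonneg mult_nonneg_nonneg) auto
qed simp

lemma div_integrand_eq_lag: "div_integrand \<alpha> a = lag_integrand \<alpha> u 0 1 0 c a"
  by (simp add: lag_integrand_def[abs_def])

lemma div_integrand_convex:
  assumes "\<alpha> \<noteq> 0" "\<alpha> \<noteq> 1"
  shows "convex_on {0<..} (div_integrand \<alpha> a)"
  \<comment> \<open>With \<open>nu = 0\<close> the integrand is the same for all \<open>u\<close>
    and \<open>c\<close>; \<open>1/2\<close> and \<open>0\<close> are admissible values for the
    convexity lemma.\<close>
  unfolding div_integrand_eq_lag[of \<alpha> a "1/2" 0]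
  by (rule lag_integrand_convex) (use assms in auto)

text \<open>A convex function lies above its tangents, and the tangent at \<open>y = a\<close> is
  zero because value and slope both vanish there.\<close>

lemma div_integrand_nonneg:
  assumes "\<alpha> \<noteq> 0" "\<alpha> \<noteq> 1" "0 < a" "0 < y"
  shows "0 \<le> div_integrand \<alpha> a y"
proof -
  have 1: "(div_integrand \<alpha> a has_real_derivative 0) (at a)"
    using lag_integrand_has_derivative[of \<alpha> a "1/2" 0 1 0 0 a] assms
    by (simp add: div_integrand_eq_lag[of \<alpha> a "1/2" 0] lag_integrand_deriv_def flip: powr_add)
  have "div_integrand \<alpha> a y - div_integrand \<alpha> a a \<ge> 0 * (y - a)"
    by (rule convex_on_imp_above_tangent[OF div_integrand_convex])
      (use assms 1 in \<open>auto simp: interior_open intro: has_field_derivative_at_within\<close>)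
  moreover have "div_integrand \<alpha> a a = 0"
    using assms by (simp add: div_integrand_def flip: powr_add) (simp add: algebra_simps)
  ultimately show ?thesis by simp
qed

text \<open>Each factor is at most the same power of \<open>a + b\<close>, and the exponents add up
  to one. This supplies the integrable bound for affinities.\<close>

lemma powr_mult_powr_le_add:
  fixes a b :: real
  assumes "0 < u" "u < 1" "0 < a" "0 < b"
  shows "a powr u * b powr (1 - u) \<le> a + b"
proof -
  have "a powr u * b powr (1 - u) \<le> (a + b) powr u * (a + b) powr (1 - u)"
    using assms by (intro mult_mono powr_mono2) auto
  then show ?thesis using assms by (simp flip: powr_add)
qed

section \<open>Differentiation under the integral by convexity\<close>

text \<open>Chord slopes of a convex function increase, so the slope over \<open>[0, t]\<close> lies
  between those over \<open>[-r, 0]\<close> and \<open>[0, r]\<close>. The resulting bound is free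
  of \<open>t\<close>, as domination requires.\<close>

lemma convex_difference_quotient_le:
  fixes p :: "real \<Rightarrow> real"
  assumes "convex_on {-r..r} p" "0 < t" "t \<le> r"
  shows "\<bar>(p t - p 0) / t\<bar> \<le> \<bar>p r - p 0\<bar> / r + \<bar>p (- r) - p 0\<bar> / r"
proof -
  have r: "0 < r" using assms by simp
  have "p t \<le> (1 - t / r) * p 0 + t / r * p r"
    using convex_onD[OF assms(1), of "t / r" 0 r] assms r by simp
  then have "p t - p 0 \<le> t * ((p r - p 0) / r)"
    using r by (simp add: field_simps)
  then have up: "(p t - p 0) / t \<le> (p r - p 0) / r"
    using assms by (simp add: pos_divide_le_eq mult.commute)
  \<comment> \<open>The weight that writes \<open>0\<close> as a convex combination of
    \<open>t\<close> and \<open>- r\<close>.\<close>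
  define w where "w = t / (t + r)"
  have "(1 - w) * t + w * (- r) = 0" using r assms by (simp add: w_def field_simps)
  then have "p 0 \<le> (1 - w) * p t + w * p (- r)"
    using convex_onD[OF assms(1), of w t "- r"] assms r by (simp add: w_def)
  then have "(t + r) * p 0 \<le> (t + r) * ((1 - w) * p t + w * p (- r))"
    using r assms by (intro mult_left_mono) auto
  also have "\<dots> = ((t + r) * (1 - w)) * p t + ((t + r) * w) * p (- r)"
    by (simp add: algebra_simps)
  also have "\<dots> = r * p t + t * p (- r)"
  proof -
    have w: "(t + r) * w = t"
      using r assms by (simp add: w_def)
    moreover have "(t + r) * (1 - w) = r"
      unfolding right_diff_distrib w by simp
    ultimately show ?thesis by simp
  qed
  finally have "(t + r) * p 0 \<le> r * p t + t * p (- r)" .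
  then have "- ((p (- r) - p 0) / r) \<le> (p t - p 0) / t"
    using r assms by (simp add: field_simps)
  moreover have "\<bar>p r - p 0\<bar> / r \<ge> (p r - p 0) / r" "\<bar>p r - p 0\<bar> / r \<ge> 0"
    "\<bar>p (- r) - p 0\<bar> / r \<ge> (p (- r) - p 0) / r" "\<bar>p (- r) - p 0\<bar> / r \<ge> 0"
    using r by (auto intro: divide_right_mono)
  ultimately show ?thesis using up by linarith
qed

lemma convex_abs_difference_quotient_le:
  fixes p :: "real \<Rightarrow> real"
  assumes "convex_on {-r..r} p" "t \<noteq> 0" "\<bar>t\<bar> \<le> r"
  shows "\<bar>(p t - p 0) / t\<bar> \<le> \<bar>p r - p 0\<bar> / r + \<bar>p (- r) - p 0\<bar> / r"
proof (cases "0 < t")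
  case True
  then show ?thesis using convex_difference_quotient_le assms by simp
next
  case False
  \<comment> \<open>Negative \<open>t\<close> is reduced to positive \<open>t\<close> by reflection,
    which only swaps the two endpoint terms of the bound.\<close>
  have "convex_on {-r..r} (\<lambda>s. p (- s))"
  proof (rule convex_onI)
    fix s x y :: real assume *: "0 < s" "s < 1" "x \<in> {-r..r}" "y \<in> {-r..r}"
    have "p ((1 - s) *\<^sub>R (- x) + s *\<^sub>R (- y)) \<le> (1 - s) * p (- x) + s * p (- y)"
      by (rule convex_onD[OF assms(1)]) (use * in auto)
    then show "p (- ((1 - s) *\<^sub>R x + s *\<^sub>R y)) \<le> (1 - s) * p (- x) + s * p (- y)"
      by (simp add: algebra_simps)
  qed simp
  from convex_difference_quotient_le[OF this, of "- t"] False assms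
  show ?thesis by (simp add: add.commute)
qed

text \<open>The chord slopes at \<open>r\<close> and \<open>- r\<close> form an integrable majorant
  of all difference quotients, so dominated convergence applies. Integrability of the derivative
  comes out of the same limit.\<close>

lemma has_real_derivative_integral_convex:
  fixes \<phi> :: "real \<Rightarrow> 'a \<Rightarrow> real"
  assumes "0 < r"
    and int: "\<And>t. \<bar>t\<bar> \<le> r \<Longrightarrow> integrable M (\<phi> t)"
    and conv: "AE x in M. convex_on {-r..r} (\<lambda>t. \<phi> t x)"
    and deriv: "AE x in M. ((\<lambda>t. \<phi> t x) has_real_derivative \<phi>' x) (at 0)"
    and meas: "\<phi>' \<in> borel_measurable M"
  shows "integrable M \<phi>'"
    and "((\<lambda>t. LINT x|M. \<phi> t x) has_real_derivative (LINT x|M. \<phi>' x)) (at 0)"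
proof -
  define w where "w x = \<bar>\<phi> r x - \<phi> 0 x\<bar> / r + \<bar>\<phi> (- r) x - \<phi> 0 x\<bar> / r" for x
  have w: "integrable M w"
    unfolding w_def using int[of r] int[of "-r"] int[of 0] \<open>0 < r\<close> by auto
  define q where "q t x = (\<phi> t x - \<phi> 0 x) / t" for t x
  have conclusion: "integrable M \<phi>' \<and> (\<lambda>n. LINT x|M. q (X n) x) \<longlonglongrightarrow> (LINT x|M. \<phi>' x)"
    if X: "\<And>n. X n \<noteq> 0" "\<And>n. \<bar>X n\<bar> \<le> r" "X \<longlonglongrightarrow> 0" for X :: "nat \<Rightarrow> real"
  proof -
    have 1: "q (X n) \<in> borel_measurable M" for n
      unfolding q_def using int[of "X n"] int[of 0] X \<open>0 < r\<close> by auto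
    have 2: "AE x in M. (\<lambda>n. q (X n) x) \<longlonglongrightarrow> \<phi>' x"
      using deriv
    proof eventually_elim
      case (elim x)
      then have "((\<lambda>t. q t x) \<longlongrightarrow> \<phi>' x) (at 0)"
        by (simp add: has_field_derivative_iff q_def)
      then show ?case
        using X by (auto simp: tendsto_at_iff_sequentially o_def)
    qed
    have 3: "AE x in M. norm (q (X n) x) \<le> w x" for n
      using conv
      by eventually_elim
        (use convex_abs_difference_quotient_le[of r _ "X n"] X in \<open>simp add: q_def w_def\<close>)
    show ?thesis
      using integrable_dominated_convergence[OF meas 1 w 2 3]
        integral_dominated_convergence[OF meas 1 w 2 3] by simp
  qed
  \<comment> \<open>One concrete null sequence of nonzero points suffices to extract the
    integrability of \<open>\<phi>'\<close>.\<close>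
  have "(\<lambda>n. r * inverse (real (Suc n))) \<longlonglongrightarrow> r * 0"
    by (intro tendsto_intros LIMSEQ_inverse_real_of_nat)
  moreover have "\<bar>r * inverse (real (Suc n))\<bar> \<le> r" "r * inverse (real (Suc n)) \<noteq> 0" for n
    using \<open>0 < r\<close> by (auto simp: field_simps)
  ultimately show "integrable M \<phi>'"
    using conclusion[of "\<lambda>n. r * inverse (real (Suc n))"] by simp
  \<comment> \<open>Restricting to \<open>{-r..r}\<close> makes every test sequence obey the bound;
    since \<open>0\<close> is interior, the restricted limit is the full one.\<close>
  have "((\<lambda>t. LINT x|M. q t x) \<longlongrightarrow> (LINT x|M. \<phi>' x)) (at 0 within {-r..r})"
    unfolding tendsto_at_iff_sequentially o_def
  proof (intro allI impI)
    fix X :: "nat \<Rightarrow> real" assume X: "\<forall>i. X i \<in> {-r..r} - {0}" "X \<longlonglongrightarrow> 0"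
    have "X n \<noteq> 0" "\<bar>X n\<bar> \<le> r" for n
      using X(1)[rule_format, of n] by (auto simp: abs_le_iff)
    then show "(\<lambda>n. LINT x|M. q (X n) x) \<longlonglongrightarrow> (LINT x|M. \<phi>' x)"
      using conclusion[OF _ _ X(2)] by simp
  qed
  then have "((\<lambda>t. LINT x|M. q t x) \<longlongrightarrow> (LINT x|M. \<phi>' x)) (at 0)"
    using \<open>0 < r\<close> by (simp add: at_within_Icc_at)
  moreover have "eventually (\<lambda>t. (LINT x|M. q t x) = ((LINT x|M. \<phi> t x) - (LINT x|M. \<phi> 0 x)) / (t - 0)) (at 0)"
    unfolding eventually_at using int[of 0] int \<open>0 < r\<close>
    by (intro exI[of _ r]) (auto simp: q_def[abs_def])
  ultimately show "((\<lambda>t. LINT x|M. \<phi> t x) has_real_derivative (LINT x|M. \<phi>' x)) (at 0)"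
    unfolding has_field_derivative_iff by (rule Lim_transform_eventually)
qed

section \<open>Densities of finite divergence from a nominal density\<close>

lemma pos_prob_densityD:
  assumes "pos_prob_density M f"
  shows "integrable M f" "f \<in> borel_measurable M" "AE x in M. 0 < f x" "(LINT x|M. f x) = 1"
proof -
  show "(LINT x|M. f x) = 1" "f \<in> borel_measurable M" "AE x in M. 0 < f x"
    using assms by (auto simp: pos_prob_density_def total_mass_def)
  then show "integrable M f"
    using not_integrable_integral_eq[of M f] by force
qed

locale alpha_nominal =
  fixes M :: "'a measure" and \<alpha> :: real and f :: "'a \<Rightarrow> real"
  assumes alpha: "\<alpha> \<noteq> 0" "\<alpha> \<noteq> 1"
    and nominal: "pos_prob_density M f"
begin

lemmas nominalD = pos_prob_densityD[OF nominal]

lemma div_integrand_measurable [measurable]: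
  assumes "g \<in> borel_measurable M"
  shows "(\<lambda>x. div_integrand \<alpha> (f x) (g x)) \<in> borel_measurable M"
  unfolding div_integrand_def using assms nominalD(2) by measurable

lemma div_integrand_AE_nonneg:
  assumes "AE x in M. 0 < g x"
  shows "AE x in M. 0 \<le> div_integrand \<alpha> (f x) (g x)"
  using nominalD(3) assms by eventually_elim (rule div_integrand_nonneg[OF alpha])

lemma alpha_div_eq: "alpha_div M \<alpha> g f = (\<integral>\<^sup>+ x. ennreal (div_integrand \<alpha> (f x) (g x)) \<partial>M)"
  by (simp add: alpha_div_def div_integrand_def)

lemma alpha_div_finite:
  assumes "AE x in M. 0 < g x" "integrable M (\<lambda>x. div_integrand \<alpha> (f x) (g x))"
  shows "alpha_div M \<alpha> g f = ennreal (LINT x|M. div_integrand \<alpha> (f x) (g x))"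
  unfolding alpha_div_eq using assms div_integrand_AE_nonneg by (intro nn_integral_eq_integral)

text \<open>The integrand is nonnegative almost everywhere, so a finite extended integral is the
  same as integrability. This allows the divergence to be handled as a real integral.\<close>

lemma lagrangian_domain_iff:
  "g \<in> lagrangian_domain M \<alpha> f \<longleftrightarrow> integrable M g \<and> (AE x in M. 0 < g x) \<and>
     integrable M (\<lambda>x. div_integrand \<alpha> (f x) (g x))"
proof -
  have "integrable M (\<lambda>x. div_integrand \<alpha> (f x) (g x))"
    if "integrable M g" "AE x in M. 0 < g x" "alpha_div M \<alpha> g f < \<infinity>"
    using that div_integrand_AE_nonneg by (intro integrableI_nonneg) (auto simp: alpha_div_eq)
  then show ?thesis
    by (auto simp: lagrangian_domain_def alpha_div_finite)
qed

lemma lagrangian_domainD: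
  assumes "g \<in> lagrangian_domain M \<alpha> f"
  shows "integrable M g" "g \<in> borel_measurable M" "AE x in M. 0 < g x"
    "integrable M (\<lambda>x. div_integrand \<alpha> (f x) (g x))"
    "alpha_div M \<alpha> g f = ennreal (LINT x|M. div_integrand \<alpha> (f x) (g x))"
    "enn2real (alpha_div M \<alpha> g f) = (LINT x|M. div_integrand \<alpha> (f x) (g x))"
proof -
  show *: "integrable M g" "AE x in M. 0 < g x" "integrable M (\<lambda>x. div_integrand \<alpha> (f x) (g x))"
    using assms by (auto simp: lagrangian_domain_iff)
  then show "g \<in> borel_measurable M" by simp
  show "alpha_div M \<alpha> g f = ennreal (LINT x|M. div_integrand \<alpha> (f x) (g x))"
    using * alpha_div_finite by simp
  then show "enn2real (alpha_div M \<alpha> g f) = (LINT x|M. div_integrand \<alpha> (f x) (g x))"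
    using * div_integrand_AE_nonneg by (simp add: integral_nonneg_AE)
qed

text \<open>The sign of \<open>\<epsilon>\<close> matters because \<open>ennreal\<close> truncates
  negative numbers to zero.\<close>

lemma feasible_iff:
  assumes "0 \<le> \<epsilon>"
  shows "feasible M \<alpha> \<epsilon> f g \<longleftrightarrow> g \<in> lagrangian_domain M \<alpha> f \<and> total_mass M g = 1 \<and>
    (LINT x|M. div_integrand \<alpha> (f x) (g x)) \<le> \<epsilon>"
proof
  assume F: "feasible M \<alpha> \<epsilon> f g"
  then have p: "pos_prob_density M g" and le: "alpha_div M \<alpha> g f \<le> ennreal \<epsilon>"
    by (auto simp: feasible_def uncertainty_class_def)
  have dom: "g \<in> lagrangian_domain M \<alpha> f"
    using pos_prob_densityD[OF p] le by (auto simp: lagrangian_domain_def order_le_less_trans)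
  with le assms have "(LINT x|M. div_integrand \<alpha> (f x) (g x)) \<le> \<epsilon>"
    by (simp add: lagrangian_domainD(5))
  with dom p show "g \<in> lagrangian_domain M \<alpha> f \<and> total_mass M g = 1 \<and>
    (LINT x|M. div_integrand \<alpha> (f x) (g x)) \<le> \<epsilon>"
    by (simp add: pos_prob_density_def)
next
  assume "g \<in> lagrangian_domain M \<alpha> f \<and> total_mass M g = 1 \<and>
    (LINT x|M. div_integrand \<alpha> (f x) (g x)) \<le> \<epsilon>"
  then have dom: "g \<in> lagrangian_domain M \<alpha> f" and "total_mass M g = 1"
    "(LINT x|M. div_integrand \<alpha> (f x) (g x)) \<le> \<epsilon>" by auto
  with lagrangian_domainD[OF dom] show "feasible M \<alpha> \<epsilon> f g"
    by (auto simp: feasible_def uncertainty_class_def pos_prob_density_def ennreal_leI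
        intro: eventually_mono[OF _ less_imp_le])
qed

text \<open>The linear terms are integrable anyway, so only the mixed power decides; unlike the
  whole integrand, it is homogeneous in \<open>g\<close>.\<close>

lemma div_integrand_finite_iff:
  assumes "integrable M g"
  shows "integrable M (\<lambda>x. div_integrand \<alpha> (f x) (g x)) \<longleftrightarrow>
    integrable M (\<lambda>x. g x powr \<alpha> * f x powr (1 - \<alpha>))"
proof -
  have "(\<lambda>x. g x powr \<alpha> * f x powr (1 - \<alpha>)) =
      (\<lambda>x. ((1 - \<alpha>) * f x + \<alpha> * g x) - (\<alpha> * (1 - \<alpha>)) * div_integrand \<alpha> (f x) (g x))"
    using alpha by (auto simp: div_integrand_def)
  moreover have "integrable M (\<lambda>x. (1 - \<alpha>) * f x + \<alpha> * g x)"
    using assms nominalD(1) by simp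
  ultimately have "integrable M (\<lambda>x. g x powr \<alpha> * f x powr (1 - \<alpha>))"
    if "integrable M (\<lambda>x. div_integrand \<alpha> (f x) (g x))"
    using that by (simp only:) (intro Bochner_Integration.integrable_diff integrable_mult_right)
  moreover have "integrable M (\<lambda>x. div_integrand \<alpha> (f x) (g x))"
    if "integrable M (\<lambda>x. g x powr \<alpha> * f x powr (1 - \<alpha>))"
    unfolding div_integrand_def using that assms nominalD(1) by simp
  ultimately show ?thesis by blast
qed

text \<open>Provides admissible directions for testing stationarity: \<open>g\<close> is multiplied
  by one of \<open>1 - t\<close>, \<open>1\<close>, \<open>1 + t\<close>, which preserves positivity
  and changes the mixed power by a bounded factor.\<close>

lemma relative_perturbation_in_domain:
  assumes g: "g \<in> lagrangian_domain M \<alpha> f"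
    and s: "s \<in> borel_measurable M" "\<And>x. s x \<in> {- 1, 0, 1}" and t: "\<bar>t\<bar> < 1"
  shows "(\<lambda>x. g x + t * (s x * g x)) \<in> lagrangian_domain M \<alpha> f"
proof -
  note gD = lagrangian_domainD[OF g]
  have pos: "0 < 1 + t * s x" for x
    using s(2)[of x] t by auto
  have eq: "g x + t * (s x * g x) = (1 + t * s x) * g x" for x
    by (simp add: algebra_simps)
  have int: "integrable M (\<lambda>x. (1 + t * s x) * g x)"
  proof (rule Bochner_Integration.integrable_bound)
    show "integrable M (\<lambda>x. 2 * g x)" using gD by simp
    have "\<bar>1 + t * s x\<bar> \<le> 2" for x using s(2)[of x] t by auto
    then show "AE x in M. norm ((1 + t * s x) * g x) \<le> norm (2 * g x)"
      by (auto simp: abs_mult intro!: mult_right_mono)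
    show "(\<lambda>x. (1 + t * s x) * g x) \<in> borel_measurable M" using s gD by measurable
  qed
  have "integrable M (\<lambda>x. ((1 + t * s x) * g x) powr \<alpha> * f x powr (1 - \<alpha>))"
  proof (rule Bochner_Integration.integrable_bound)
    \<comment> \<open>The sum of the three possible values of
      \<open>(1 + t * s x) powr \<alpha>\<close>, hence an upper bound for either sign of
      \<open>\<alpha>\<close>.\<close>
    define C where "C = 1 + (1 + t) powr \<alpha> + (1 - t) powr \<alpha>"
    show "integrable M (\<lambda>x. C * (g x powr \<alpha> * f x powr (1 - \<alpha>)))"
      using gD(4) gD(1) by (simp add: div_integrand_finite_iff)
    have C: "(1 + t * s x) powr \<alpha> \<le> C" for x
      using s(2)[of x] by (auto simp: C_def intro: add_increasing add_increasing2)
    have bound: "((1 + t * s x) * g x) powr \<alpha> * f x powr (1 - \<alpha>)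
        \<le> C * (g x powr \<alpha> * f x powr (1 - \<alpha>))" if "0 < g x" for x
      using pos[of x] that mult_right_mono[OF C, of "g x powr \<alpha> * f x powr (1 - \<alpha>)" x]
      by (simp add: powr_mult mult.assoc)
    show "AE x in M. norm (((1 + t * s x) * g x) powr \<alpha> * f x powr (1 - \<alpha>))
        \<le> norm (C * (g x powr \<alpha> * f x powr (1 - \<alpha>)))"
      using gD(3) by eventually_elim (simp add: bound order_trans[OF _ abs_ge_self])
    show "(\<lambda>x. ((1 + t * s x) * g x) powr \<alpha> * f x powr (1 - \<alpha>)) \<in> borel_measurable M"
      using s gD nominalD by measurable
  qed
  moreover have "AE x in M. 0 < (1 + t * s x) * g x"
    using gD(3) by eventually_elim (simp add: pos)
  ultimately show ?thesis
    unfolding eq lagrangian_domain_iff using int by (simp add: div_integrand_finite_iff)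
qed

text \<open>The mixed power of \<open>c * f\<close> and \<open>f\<close> collapses to
  \<open>c powr \<alpha> * f\<close>.\<close>

lemma nominal_in_domain: "0 < c \<Longrightarrow> (\<lambda>x. c * f x) \<in> lagrangian_domain M \<alpha> f"
proof -
  assume c: "0 < c"
  have "AE x in M. c powr \<alpha> * f x = (c * f x) powr \<alpha> * f x powr (1 - \<alpha>)"
    using nominalD(3) by eventually_elim (use c in \<open>simp add: powr_mult mult.assoc flip: powr_add\<close>)
  then have "integrable M (\<lambda>x. (c * f x) powr \<alpha> * f x powr (1 - \<alpha>))"
    using nominalD(1,2) by (subst integrable_cong_AE[symmetric, where f = "\<lambda>x. c powr \<alpha> * f x"]) auto
  moreover have "AE x in M. 0 < c * f x" using nominalD(3) by eventually_elim (use c in simp)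
  ultimately show ?thesis
    using nominalD(1) by (simp add: lagrangian_domain_iff div_integrand_finite_iff)
qed

end

section \<open>The Lagrangian against a fixed second density \<open>h\<close>\<close>

locale affinity_constraint = alpha_nominal +
  fixes u :: real and h :: "'a \<Rightarrow> real"
  assumes u: "0 < u" "u < 1"
    and other: "pos_prob_density M h"
begin

lemmas otherD = pos_prob_densityD[OF other]

abbreviation lag :: "real \<Rightarrow> real \<Rightarrow> real \<Rightarrow> ('a \<Rightarrow> real) \<Rightarrow> 'a \<Rightarrow> real" where
  "lag nu lam mu g x \<equiv> lag_integrand \<alpha> u nu lam mu (h x powr u) (f x) (g x)"

lemma affinity_integrable:
  assumes "integrable M g" "AE x in M. 0 < g x"
  shows "integrable M (\<lambda>x. h x powr u * g x powr (1 - u))"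
proof (rule Bochner_Integration.integrable_bound)
  show "integrable M (\<lambda>x. h x + g x)" using assms otherD by simp
  show "AE x in M. norm (h x powr u * g x powr (1 - u)) \<le> norm (h x + g x)"
    using assms(2) otherD(3)
    by eventually_elim (simp add: powr_mult_powr_le_add[OF u] order_trans[OF _ abs_ge_self])
qed (use assms otherD in measurable)

lemma lag_integral:
  assumes "g \<in> lagrangian_domain M \<alpha> f"
  shows "integrable M (lag nu lam mu g)"
    and "(LINT x|M. lag nu lam mu g x) = lam * (LINT x|M. div_integrand \<alpha> (f x) (g x))
      + mu * total_mass M g - nu * u_affinity M u g h"
  using lagrangian_domainD[OF assms] affinity_integrable[of g]
  by (simp_all add: lag_integrand_def total_mass_def u_affinity_def)

lemma lagrangian_eq:
  assumes "g \<in> lagrangian_domain M \<alpha> f"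
  shows "lagrangian M \<alpha> \<epsilon> f (\<lambda>g. u_affinity M u g h) lam mu g =
    lam * \<epsilon> + mu - (LINT x|M. lag 1 lam mu g x)"
  by (simp add: lagrangian_def lag_integral(2)[OF assms] lagrangian_domainD(6)[OF assms] algebra_simps)

lemma mixture:
  assumes g: "g \<in> lagrangian_domain M \<alpha> f" and g': "g' \<in> lagrangian_domain M \<alpha> f"
    and w: "0 \<le> v" "0 \<le> w" "v + w = 1"
  shows "(\<lambda>x. v * g x + w * g' x) \<in> lagrangian_domain M \<alpha> f"
    and "0 \<le> nu \<Longrightarrow> 0 \<le> lam \<Longrightarrow> (LINT x|M. lag nu lam mu (\<lambda>x. v * g x + w * g' x) x)
      \<le> v * (LINT x|M. lag nu lam mu g x) + w * (LINT x|M. lag nu lam mu g' x)"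
proof -
  note gD = lagrangian_domainD[OF g] lagrangian_domainD[OF g']
  have conv: "AE x in M. lag nu lam mu (\<lambda>x. v * g x + w * g' x) x
      \<le> v * lag nu lam mu g x + w * lag nu lam mu g' x"
    if "0 \<le> nu" "0 \<le> lam" for nu lam mu
    using gD(3) gD(9)
  proof eventually_elim
    case (elim x)
    have "lag_integrand \<alpha> u nu lam mu (h x powr u) (f x) ((1 - w) *\<^sub>R g x + w *\<^sub>R g' x)
       \<le> (1 - w) * lag nu lam mu g x + w * lag nu lam mu g' x"
      by (rule convex_onD[OF lag_integrand_convex]) (use alpha u that w elim in auto)
    moreover have "v = 1 - w" using w by simp
    ultimately show ?case by simp
  qed
  have pos: "AE x in M. 0 < v * g x + w * g' x"
    using gD(3) gD(9)
  proof eventually_elim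
    case (elim x)
    then show ?case using w
      by (cases "v = 0") (auto intro: add_pos_nonneg)
  qed
  have "integrable M (\<lambda>x. div_integrand \<alpha> (f x) (v * g x + w * g' x))"
  proof (rule Bochner_Integration.integrable_bound)
    show "integrable M (\<lambda>x. v * div_integrand \<alpha> (f x) (g x) + w * div_integrand \<alpha> (f x) (g' x))"
      using gD by simp
    show "(\<lambda>x. div_integrand \<alpha> (f x) (v * g x + w * g' x)) \<in> borel_measurable M"
      using gD by measurable
    \<comment> \<open>At \<open>nu = 0\<close>, \<open>lam = 1\<close>, \<open>mu = 0\<close> the
      inequality \<open>conv\<close> is convexity of the divergence integrand; nonnegativity turns
      it into a bound on the absolute value.\<close>
    show "AE x in M. norm (div_integrand \<alpha> (f x) (v * g x + w * g' x))
        \<le> norm (v * div_integrand \<alpha> (f x) (g x) + w * div_integrand \<alpha> (f x) (g' x))"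
      using conv[OF order_refl zero_le_one, of 0] div_integrand_AE_nonneg[OF pos]
      by eventually_elim (simp add: lag_integrand_def)
  qed
  then show dom: "(\<lambda>x. v * g x + w * g' x) \<in> lagrangian_domain M \<alpha> f"
    using gD pos by (simp add: lagrangian_domain_iff)
  show "(LINT x|M. lag nu lam mu (\<lambda>x. v * g x + w * g' x) x)
      \<le> v * (LINT x|M. lag nu lam mu g x) + w * (LINT x|M. lag nu lam mu g' x)"
    if "0 \<le> nu" "0 \<le> lam"
    using integral_mono_AE[OF _ _ conv[OF that, of mu]] lag_integral(1)[OF g] lag_integral(1)[OF g']
      lag_integral(1)[OF dom] by simp
qed

text \<open>On the domain the Lagrangian is a constant minus the integral of \<open>lag\<close>, and
  \<open>lag\<close> is convex along the line through \<open>g\<close>, so the differentiation lemma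
  for convex integrands applies.\<close>

lemma lagrangian_Gateaux_derivative:
  fixes mu :: real
  assumes lam: "0 \<le> lam" and psi: "\<psi> \<in> borel_measurable M" and "0 < \<delta>"
    and dom: "\<And>t. \<bar>t\<bar> < \<delta> \<Longrightarrow> (\<lambda>x. g x + t * \<psi> x) \<in> lagrangian_domain M \<alpha> f"
  defines "D \<equiv> \<lambda>x. lag_integrand_deriv \<alpha> u 1 lam mu (h x powr u) (f x) (g x) * \<psi> x"
  shows "integrable M D"
    and "((\<lambda>t. lagrangian M \<alpha> \<epsilon> f (\<lambda>g. u_affinity M u g h) lam mu (\<lambda>x. g x + t * \<psi> x))
      has_real_derivative - (LINT x|M. D x)) (at 0)"
proof -
  \<comment> \<open>Halving \<open>\<delta>\<close> puts the closed interval, endpoints included,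
    inside the range where the perturbed density is in the domain.\<close>
  define r where "r = \<delta> / 2"
  have r: "0 < r" "r < \<delta>" using \<open>0 < \<delta>\<close> by (auto simp: r_def)
  have g: "g \<in> lagrangian_domain M \<alpha> f" using dom[of 0] \<open>0 < \<delta>\<close> by simp
  note gD = lagrangian_domainD[OF g]
  define \<phi> where "\<phi> t = lag 1 lam mu (\<lambda>x. g x + t * \<psi> x)" for t
  have D_meas: "D \<in> borel_measurable M"
    unfolding D_def lag_integrand_deriv_def using gD psi otherD nominalD by measurable
  have deriv: "AE x in M. ((\<lambda>t. \<phi> t x) has_real_derivative D x) (at 0)"
    using gD(3)
  proof eventually_elim
    case (elim x)
    have "((\<lambda>t. g x + t * \<psi> x) has_real_derivative \<psi> x) (at 0)"
      by (auto intro!: derivative_eq_intros)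
    from DERIV_chain2[OF _ this] lag_integrand_has_derivative[OF alpha elim]
    show ?case by (simp add: \<phi>_def D_def)
  qed
  have conv: "AE x in M. convex_on {-r..r} (\<lambda>t. \<phi> t x)"
  proof -
    have "AE x in M. 0 < g x + r * \<psi> x" "AE x in M. 0 < g x + (- r) * \<psi> x"
      using r by (intro lagrangian_domainD(3) dom; simp)+
    then show ?thesis
    proof eventually_elim
      case (elim x)
      \<comment> \<open>Positivity at both endpoints keeps the whole segment in the half-line on
        which the integrand is convex.\<close>
      have abs: "\<bar>r * \<psi> x\<bar> < g x"
        using elim r by auto
      have pos: "0 < g x + t * \<psi> x" if "t \<in> {-r..r}" for t
      proof -
        have "\<bar>t * \<psi> x\<bar> \<le> \<bar>r * \<psi> x\<bar>"
          using that by (auto simp: abs_mult intro!: mult_right_mono)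
        then show ?thesis using abs by linarith
      qed
      have lin: "g x + ((1 - w) *\<^sub>R s + w *\<^sub>R t) * \<psi> x = (1 - w) *\<^sub>R (g x + s * \<psi> x) + w *\<^sub>R (g x + t * \<psi> x)"
        for w s t by (simp add: algebra_simps)
      show ?case
        unfolding \<phi>_def
      proof (rule convex_onI)
        fix w s t :: real assume *: "0 < w" "w < 1" "s \<in> {-r..r}" "t \<in> {-r..r}"
        show "lag 1 lam mu (\<lambda>x. g x + ((1 - w) *\<^sub>R s + w *\<^sub>R t) * \<psi> x) x
          \<le> (1 - w) * lag 1 lam mu (\<lambda>x. g x + s * \<psi> x) x + w * lag 1 lam mu (\<lambda>x. g x + t * \<psi> x) x"
          unfolding lin
          by (rule convex_onD[OF lag_integrand_convex]) (use alpha u lam pos * in auto)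
      qed simp
    qed
  qed
  have int: "integrable M (\<phi> t)" if "\<bar>t\<bar> \<le> r" for t
    unfolding \<phi>_def using that r by (intro lag_integral dom) auto
  note R = has_real_derivative_integral_convex[OF r(1) int conv deriv D_meas]
  show "integrable M D" by (rule R(1))
  have "((\<lambda>t. lam * \<epsilon> + mu - (LINT x|M. \<phi> t x)) has_real_derivative - (LINT x|M. D x)) (at 0)"
    using R(2) by (auto intro!: derivative_eq_intros)
  \<comment> \<open>The integral formula for the Lagrangian is available only for
    \<open>\<bar>t\<bar> < \<delta>\<close>, which is enough for a derivative at
    \<open>0\<close>.\<close>
  moreover have "eventually (\<lambda>t. lam * \<epsilon> + mu - (LINT x|M. \<phi> t x) =
      lagrangian M \<alpha> \<epsilon> f (\<lambda>g. u_affinity M u g h) lam mu (\<lambda>x. g x + t * \<psi> x)) (nhds 0)"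
    unfolding eventually_nhds_metric \<phi>_def using \<open>0 < \<delta>\<close> lagrangian_eq[OF dom]
    by (intro exI[of _ \<delta>]) (auto simp: dist_real_def)
  ultimately show "((\<lambda>t. lagrangian M \<alpha> \<epsilon> f (\<lambda>g. u_affinity M u g h) lam mu (\<lambda>x. g x + t * \<psi> x))
      has_real_derivative - (LINT x|M. D x)) (at 0)"
    by (subst DERIV_cong_ev[OF refl _ refl, symmetric])
qed

text \<open>The sign direction turns the derivative into minus the integral of
  \<open>\<bar>d x\<bar> * g x\<close>; a nonnegative function with zero integral vanishes almost
  everywhere, and \<open>g\<close> is positive.\<close>

lemma stationary_imp_derivative_zero:
  assumes "kkt_multipliers M \<alpha> \<epsilon> f (\<lambda>g. u_affinity M u g h) g lam mu" "0 \<le> \<epsilon>"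
  shows "AE x in M. lag_integrand_deriv \<alpha> u 1 lam mu (h x powr u) (f x) (g x) = 0"
proof -
  define d where "d x = lag_integrand_deriv \<alpha> u 1 lam mu (h x powr u) (f x) (g x)" for x
  have g: "g \<in> lagrangian_domain M \<alpha> f" and lam: "0 \<le> lam"
    using assms by (auto simp: kkt_multipliers_def feasible_iff)
  note gD = lagrangian_domainD[OF g]
  have d_meas: "d \<in> borel_measurable M"
    unfolding d_def lag_integrand_deriv_def using gD otherD nominalD by measurable
  define \<psi> where "\<psi> x = sgn (d x) * g x" for x
  have psi: "\<psi> \<in> borel_measurable M" using d_meas gD unfolding \<psi>_def by measurable
  have dom: "(\<lambda>x. g x + t * \<psi> x) \<in> lagrangian_domain M \<alpha> f" if "\<bar>t\<bar> < 1" for t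
    unfolding \<psi>_def using d_meas that
    by (intro relative_perturbation_in_domain[OF g]) (auto simp: sgn_real_def)
  have "((\<lambda>t. lagrangian M \<alpha> \<epsilon> f (\<lambda>g. u_affinity M u g h) lam mu (\<lambda>x. g x + t * \<psi> x))
      has_real_derivative 0) (at 0)"
    using assms(1) psi dom unfolding kkt_multipliers_def by (meson zero_less_one)
  from DERIV_unique[OF this lagrangian_Gateaux_derivative(2)[OF lam psi zero_less_one dom]]
  have "(LINT x|M. d x * \<psi> x) = 0" by (simp add: d_def)
  moreover have "integrable M (\<lambda>x. d x * \<psi> x)"
    using lagrangian_Gateaux_derivative(1)[OF lam psi zero_less_one dom] by (simp add: d_def)
  moreover have "AE x in M. d x * \<psi> x = \<bar>d x\<bar> * g x"
    by (simp add: \<psi>_def abs_sgn mult.assoc)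
  moreover from this gD(3) have "AE x in M. 0 \<le> d x * \<psi> x"
    by eventually_elim simp
  ultimately have "AE x in M. d x * \<psi> x = 0"
    by (simp add: integral_nonneg_eq_0_iff_AE)
  with gD(3) show ?thesis
    unfolding d_def[symmetric]
    by eventually_elim (auto simp: \<psi>_def sgn_0_0)
qed

section \<open>Existence of multipliers\<close>

lemma Fritz_John_multipliers:
  assumes "0 < \<epsilon>" and max: "is_arg_max (\<lambda>g. u_affinity M u g h) (feasible M \<alpha> \<epsilon> f) g"
  obtains mu lam nu where "(mu, lam, nu) \<noteq> (0, 0, 0)" "0 \<le> lam" "0 \<le> nu"
    "\<And>k. k \<in> lagrangian_domain M \<alpha> f \<Longrightarrow>
      0 \<le> mu * (total_mass M k - 1) + lam * ((LINT x|M. div_integrand \<alpha> (f x) (k x)) - \<epsilon>)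
        + nu * (u_affinity M u g h - u_affinity M u k h)"
proof -
  define dv where "dv k = (LINT x|M. div_integrand \<alpha> (f x) (k x))" for k
  \<comment> \<open>The mass is affine and enters as an equality; the two convex functionals enter
    through strict upper bounds, which makes the set convex and upward closed in \<open>b\<close>
    and \<open>c\<close>.\<close>
  define S where "S = {(a, b, c) | a b c. \<exists>k \<in> lagrangian_domain M \<alpha> f. a = total_mass M k - 1 \<and>
    dv k - \<epsilon> < b \<and> u_affinity M u g h - u_affinity M u k h < c}"
  have "convex S"
  proof (rule convexI)
    fix p q :: "real \<times> real \<times> real" and v w :: real
    assume "p \<in> S" "q \<in> S" and w: "0 \<le> v" "0 \<le> w" "v + w = 1"
    then obtain a b c k a' b' c' k' where
      p: "p = (a, b, c)" "k \<in> lagrangian_domain M \<alpha> f" "a = total_mass M k - 1" "dv k - \<epsilon> < b"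
        "u_affinity M u g h - u_affinity M u k h < c" and
      q: "q = (a', b', c')" "k' \<in> lagrangian_domain M \<alpha> f" "a' = total_mass M k' - 1" "dv k' - \<epsilon> < b'"
        "u_affinity M u g h - u_affinity M u k' h < c'"
      unfolding S_def by blast
    define m where "m x = v * k x + w * k' x" for x
    have absorb: "v * y + w * y = y" for y :: real
      using w by (simp flip: distrib_right)
    \<comment> \<open>Strictness survives a vanishing weight because the other weight is then
      one.\<close>
    have strict: "v * y + w * y' < v * z + w * z'" if "y < z" "y' < z'" for y y' z z' :: real
      using w that
      by (cases "v = 0") (auto intro!: add_less_le_mono mult_strict_left_mono mult_left_mono)
    have m: "m \<in> lagrangian_domain M \<alpha> f"
      unfolding m_def by (rule mixture) (use p q w in auto)
    have mass: "total_mass M m = v * total_mass M k + w * total_mass M k'"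
      unfolding total_mass_def m_def using lagrangian_domainD(1) p(2) q(2) by simp
    \<comment> \<open>The coefficients \<open>0 1 0\<close> single out the divergence;
      \<open>1 0 0\<close> below single out the negative affinity.\<close>
    have "dv m \<le> v * dv k + w * dv k'"
      using mixture(2)[OF p(2) q(2) w, of 0 1 0, folded m_def]
      by (simp add: lag_integral(2)[OF m] lag_integral(2)[OF p(2)] lag_integral(2)[OF q(2)] dv_def)
    then have "dv m - \<epsilon> < v * b + w * b'"
      using strict[OF p(4) q(4)] absorb[of \<epsilon>] unfolding right_diff_distrib by linarith
    moreover have "u_affinity M u m h \<ge> v * u_affinity M u k h + w * u_affinity M u k' h"
      using mixture(2)[OF p(2) q(2) w, of 1 0 0, folded m_def]
      by (simp add: lag_integral(2)[OF m] lag_integral(2)[OF p(2)] lag_integral(2)[OF q(2)])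
    then have "u_affinity M u g h - u_affinity M u m h < v * c + w * c'"
      using strict[OF p(5) q(5)] absorb[of "u_affinity M u g h"] unfolding right_diff_distrib
      by linarith
    moreover have "total_mass M m - 1 = v * a + w * a'"
      unfolding p(3) q(3) mass right_diff_distrib using absorb[of 1] by linarith
    ultimately have "(v * a + w * a', v * b + w * b', v * c + w * c') \<in> S"
      unfolding S_def using m by (auto intro!: bexI[of _ m])
    then show "v *\<^sub>R p + w *\<^sub>R q \<in> S"
      by (simp add: p(1) q(1))
  qed
  \<comment> \<open>A density representing the origin would be feasible with a larger affinity than
    the maximizer \<open>g\<close>.\<close>
  moreover have "0 \<notin> S"
  proof
    assume "0 \<in> S"
    then obtain k where "k \<in> lagrangian_domain M \<alpha> f" "total_mass M k = 1" "dv k < \<epsilon>"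
      "u_affinity M u g h < u_affinity M u k h"
      by (auto simp: S_def zero_prod_def)
    then show False
      using max \<open>0 < \<epsilon>\<close> by (auto simp: is_arg_max_def feasible_iff dv_def)
  qed
  ultimately obtain z where z: "z \<noteq> 0" "\<And>s. s \<in> S \<Longrightarrow> 0 \<le> inner z s"
    using separating_hyperplane_set_0 by blast
  obtain mu lam nu where z_eq: "z = (mu, lam, nu)" by (cases z) auto
  have sep: "0 \<le> mu * (total_mass M k - 1) + lam * (dv k - \<epsilon> + b)
      + nu * (u_affinity M u g h - u_affinity M u k h + c)"
    if "k \<in> lagrangian_domain M \<alpha> f" "0 < b" "0 < c" for k b c
  proof -
    have "(total_mass M k - 1, dv k - \<epsilon> + b, u_affinity M u g h - u_affinity M u k h + c) \<in> S"
      unfolding S_def using that by auto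
    from z(2)[OF this] show ?thesis by (simp add: z_eq)
  qed
  have f: "f \<in> lagrangian_domain M \<alpha> f" using nominal_in_domain[of 1] by simp
  \<comment> \<open>An affine function that is nonnegative on the positive half-line has nonnegative
    slope: for \<open>y < 0\<close> its value at \<open>1 - \<bar>x\<bar> / y\<close> is
    \<open>x + y - \<bar>x\<bar>\<close>, which is negative.\<close>
  have nonneg: "0 \<le> y" if "\<And>b. 0 < b \<Longrightarrow> 0 \<le> x + y * b" for x y :: real
  proof (rule ccontr)
    assume neg: "\<not> 0 \<le> y"
    then have "0 < 1 - \<bar>x\<bar> / y" "y * (1 - \<bar>x\<bar> / y) = y - \<bar>x\<bar>"
      by (auto simp: right_diff_distrib divide_nonneg_neg intro: order_le_less_trans[of _ 0])
    with that[of "1 - \<bar>x\<bar> / y"] neg show False by linarith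
  qed
  have "0 \<le> lam"
    by (rule nonneg[of "mu * (total_mass M f - 1) + lam * (dv f - \<epsilon>)
        + nu * (u_affinity M u g h - u_affinity M u f h + 1)"])
      (use sep[OF f _ zero_less_one] in \<open>simp add: algebra_simps\<close>)
  moreover have "0 \<le> nu"
    by (rule nonneg[of "mu * (total_mass M f - 1) + lam * (dv f - \<epsilon> + 1)
        + nu * (u_affinity M u g h - u_affinity M u f h)"])
      (use sep[OF f zero_less_one] in \<open>simp add: algebra_simps\<close>)
  moreover have "0 \<le> mu * (total_mass M k - 1) + lam * (dv k - \<epsilon>)
      + nu * (u_affinity M u g h - u_affinity M u k h)" if k: "k \<in> lagrangian_domain M \<alpha> f" for k
  \<comment> \<open>Both strict slacks are set to the same \<open>b\<close>, which tends to
    \<open>0\<close> from the right.\<close>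
  proof (rule tendsto_lowerbound)
    show "((\<lambda>b. mu * (total_mass M k - 1) + lam * (dv k - \<epsilon> + b)
      + nu * (u_affinity M u g h - u_affinity M u k h + b)) \<longlongrightarrow> mu * (total_mass M k - 1)
      + lam * (dv k - \<epsilon>) + nu * (u_affinity M u g h - u_affinity M u k h)) (at_right 0)"
      by (auto intro!: tendsto_eq_intros)
    show "eventually (\<lambda>b. 0 \<le> mu * (total_mass M k - 1) + lam * (dv k - \<epsilon> + b)
      + nu * (u_affinity M u g h - u_affinity M u k h + b)) (at_right 0)"
      using eventually_at_right_less by eventually_elim (rule sep[OF k])
  qed simp
  ultimately show ?thesis
    using that[of mu lam nu] z(1) by (simp add: z_eq dv_def zero_prod_def)
qed

text \<open>Once the objective's multiplier is scaled to one, \<open>g\<close> maximizes the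
  Lagrangian over its whole domain, and stationarity is Fermat's rule along each admissible
  line.\<close>

lemma kkt_multipliers_exist:
  assumes "0 < \<epsilon>" and max: "is_arg_max (\<lambda>g. u_affinity M u g h) (feasible M \<alpha> \<epsilon> f) g"
  shows "\<exists>lam mu. kkt_multipliers M \<alpha> \<epsilon> f (\<lambda>g. u_affinity M u g h) g lam mu"
proof -
  define dv where "dv k = (LINT x|M. div_integrand \<alpha> (f x) (k x))" for k
  obtain mu lam nu where ne: "(mu, lam, nu) \<noteq> (0, 0, 0)" and "0 \<le> lam" "0 \<le> nu" and
    FJ: "\<And>k. k \<in> lagrangian_domain M \<alpha> f \<Longrightarrow>
      0 \<le> mu * (total_mass M k - 1) + lam * (dv k - \<epsilon>) + nu * (u_affinity M u g h - u_affinity M u k h)"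
    using Fritz_John_multipliers[OF assms] unfolding dv_def by blast
  have feas: "feasible M \<alpha> \<epsilon> f g" using max by (simp add: is_arg_max_def)
  then have g: "g \<in> lagrangian_domain M \<alpha> f" "total_mass M g = 1" "dv g \<le> \<epsilon>"
    using \<open>0 < \<epsilon>\<close> by (auto simp: feasible_iff dv_def)
  have mass_f: "total_mass M (\<lambda>x. c * f x) = c" for c
    using nominalD(4) by (simp add: total_mass_def)
  \<comment> \<open>Slater's argument: without the objective, testing with \<open>f\<close> forces
    \<open>lam = 0\<close>, and then the masses \<open>1/2\<close> and \<open>2\<close> force
    \<open>mu = 0\<close>.\<close>
  have "nu \<noteq> 0"
  proof
    assume nu: "nu = 0"
    have "AE x in M. div_integrand \<alpha> (f x) (f x) = 0"
      using nominalD(3)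
      by eventually_elim (simp add: div_integrand_def left_diff_distrib flip: powr_add)
    then have "dv f = 0"
      unfolding dv_def by (rule integral_eq_zero_AE)
    then have "0 \<le> lam * - \<epsilon>"
      using FJ[OF nominal_in_domain[of 1]] mass_f[of 1] nu by simp
    then have lam: "lam = 0"
      using \<open>0 \<le> lam\<close> \<open>0 < \<epsilon>\<close> by (simp add: mult_le_0_iff)
    have "mu = 0"
      using FJ[OF nominal_in_domain[of "1/2"], unfolded mass_f nu lam]
        FJ[OF nominal_in_domain[of 2], unfolded mass_f nu lam] by simp
    with nu lam ne show False by simp
  qed
  with \<open>0 \<le> nu\<close> have nu: "0 < nu" by simp
  define lam' mu' where "lam' = lam / nu" and "mu' = mu / nu"
  have lam': "0 \<le> lam'" using \<open>0 \<le> lam\<close> nu by (simp add: lam'_def)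
  have KKT: "u_affinity M u k h \<le> u_affinity M u g h + mu' * (total_mass M k - 1) + lam' * (dv k - \<epsilon>)"
    if "k \<in> lagrangian_domain M \<alpha> f" for k
  proof -
    have "0 \<le> (mu * (total_mass M k - 1) + lam * (dv k - \<epsilon>)
        + nu * (u_affinity M u g h - u_affinity M u k h)) / nu"
      using FJ[OF that] nu by simp
    also have "\<dots> = mu' * (total_mass M k - 1) + lam' * (dv k - \<epsilon>)
        + (u_affinity M u g h - u_affinity M u k h)"
      using nu by (simp add: lam'_def mu'_def add_divide_distrib)
    finally show ?thesis by simp
  qed
  \<comment> \<open>\<open>KKT\<close> at \<open>k = g\<close> gives one sign, feasibility of
    \<open>g\<close> the other.\<close>
  have slack: "lam' * (\<epsilon> - dv g) = 0"
    using KKT[OF g(1)] g(2) mult_nonneg_nonneg[OF lam', of "\<epsilon> - dv g"] g(3)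
    by (auto simp: algebra_simps)
  \<comment> \<open>By slackness and unit mass, the Lagrangian at \<open>g\<close> is just the
    affinity, so this is \<open>KKT\<close> rearranged.\<close>
  have Lmax: "lagrangian M \<alpha> \<epsilon> f (\<lambda>g. u_affinity M u g h) lam' mu' k
      \<le> lagrangian M \<alpha> \<epsilon> f (\<lambda>g. u_affinity M u g h) lam' mu' g"
    if "k \<in> lagrangian_domain M \<alpha> f" for k
    using KKT[OF that] slack g(2)
    unfolding lagrangian_def dv_def lagrangian_domainD(6)[OF that] lagrangian_domainD(6)[OF g(1)]
      right_diff_distrib g(2) by linarith
  have "((\<lambda>t. lagrangian M \<alpha> \<epsilon> f (\<lambda>g. u_affinity M u g h) lam' mu' (\<lambda>x. g x + t * \<psi> x))
      has_real_derivative 0) (at 0)"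
    if psi: "\<psi> \<in> borel_measurable M" and d: "0 < \<delta>"
      "\<And>t. \<bar>t\<bar> < \<delta> \<Longrightarrow> (\<lambda>x. g x + t * \<psi> x) \<in> lagrangian_domain M \<alpha> f" for \<psi> \<delta>
  proof -
    note D = lagrangian_Gateaux_derivative(2)[OF lam' psi d, where \<epsilon> = \<epsilon> and mu = mu']
    from DERIV_local_max[OF D d(1)] Lmax[OF d(2)] D show ?thesis by simp
  qed
  then have "kkt_multipliers M \<alpha> \<epsilon> f (\<lambda>g. u_affinity M u g h) g lam' mu'"
    using feas lam' slack lagrangian_domainD(6)[OF g(1)]
    unfolding kkt_multipliers_def dv_def by auto
  then show ?thesis by blast
qed

section \<open>Solving the stationarity equation\<close>

text \<open>Stationarity is linear in \<open>(g x / f x) powr (\<alpha> - 1)\<close>. Solving for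
  this power leaves \<open>h x / g x\<close> on the other side, so the formula is implicit in
  \<open>g\<close>.\<close>

lemma least_favorable_formula:
  assumes kkt: "kkt_multipliers M \<alpha> \<epsilon> f (\<lambda>g. u_affinity M u g h) g lam mu" and "0 \<le> \<epsilon>" "lam \<noteq> 0"
  defines "base \<equiv> \<lambda>x. (1 - \<alpha>) / lam * (mu - (1 - u) * (h x / g x) powr u) + 1"
  shows "AE x in M. 0 < base x \<and> g x = base x powr (1 / (\<alpha> - 1)) * f x"
proof -
  have g: "AE x in M. 0 < g x"
    using kkt by (auto simp: kkt_multipliers_def feasible_def pos_prob_density_def)
  show ?thesis
    using stationary_imp_derivative_zero[OF assms(1,2)] g nominalD(3) otherD(3)
  proof eventually_elim
    case (elim x)
    have "g x powr (\<alpha> - 1) * f x powr (1 - \<alpha>) = (g x / f x) powr (\<alpha> - 1)"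
      using elim by (simp add: powr_divide powr_diff)
    moreover have "h x powr u * g x powr (- u) = (h x / g x) powr u"
      using elim by (simp add: powr_divide powr_minus_divide)
    ultimately have "lam / (1 - \<alpha>) * (1 - (g x / f x) powr (\<alpha> - 1)) + mu
        - (1 - u) * (h x / g x) powr u = 0"
      using elim(1) by (simp add: lag_integrand_deriv_def mult.left_commute)
    \<comment> \<open>Being a power of a positive ratio, \<open>base x\<close> is positive, and the
      exponent \<open>1 / (\<alpha> - 1)\<close> recovers the ratio.\<close>
    then have base: "base x = (g x / f x) powr (\<alpha> - 1)"
      using alpha \<open>lam \<noteq> 0\<close> by (simp add: base_def field_simps)
    then have "base x powr (1 / (\<alpha> - 1)) = g x / f x"
      using elim alpha by (simp add: powr_powr)
    with base elim show ?case by simp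
  qed
qed

text \<open>The degenerate case excluded by dividing by \<open>lam\<close>: stationarity makes
  \<open>h x / g x\<close> constant, and equal masses make the constant one.\<close>

lemma zero_multiplier_imp_eq:
  assumes kkt: "kkt_multipliers M \<alpha> \<epsilon> f (\<lambda>g. u_affinity M u g h) g 0 mu" and "0 \<le> \<epsilon>"
  shows "AE x in M. g x = h x"
proof -
  have p: "pos_prob_density M g"
    using kkt by (auto simp: kkt_multipliers_def feasible_def)
  \<comment> \<open>The solution of \<open>mu = (1 - u) * c powr u\<close>.\<close>
  define c where "c = (mu / (1 - u)) powr (1 / u)"
  have eq: "AE x in M. h x = c * g x"
    using stationary_imp_derivative_zero[OF assms] pos_prob_densityD(3)[OF p] otherD(3)
  proof eventually_elim
    case (elim x)
    have "h x powr u * g x powr (- u) = (h x / g x) powr u"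
      using elim by (simp add: powr_divide powr_minus_divide)
    then have "mu = (1 - u) * (h x / g x) powr u"
      using elim(1) by (simp add: lag_integrand_deriv_def mult.left_commute)
    then have "c = h x / g x"
      using elim u by (simp add: c_def powr_powr)
    then show ?case using elim by simp
  qed
  have "1 = (LINT x|M. h x)" using otherD(4) by simp
  also have "\<dots> = (LINT x|M. c * g x)"
    using eq otherD(2) pos_prob_densityD(2)[OF p] by (intro integral_cong_AE) auto
  also have "\<dots> = c" using pos_prob_densityD(4)[OF p] by simp
  finally have "c = 1" by simp
  with eq show ?thesis by (auto elim: eventually_mono)
qed

end

section \<open>Combining the two coupled maximizations\<close>

lemma u_affinity_swap: "u_affinity M u g0 g1 = u_affinity M (1 - u) g1 g0"
  by (simp add: u_affinity_def mult.commute)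

text \<open>Existence of multipliers is asserted separately so that the formulas, which hold for
  every choice of multipliers, are not vacuous.\<close>

theorem mainTheorem4:
  fixes M :: "'a measure"
    and \<alpha> u \<epsilon>0 \<epsilon>1 :: real
    and f0 f1 g0 g1 :: "'a \<Rightarrow> real"
  assumes "\<alpha> \<noteq> 0" and "\<alpha> \<noteq> 1"
    and "0 < u" and "u < 1"
    and "0 < \<epsilon>0" and "0 < \<epsilon>1"
    and "pos_prob_density M f0" and "pos_prob_density M f1"
    and "least_favorable M \<alpha> u \<epsilon>0 \<epsilon>1 f0 f1 g0 g1"
  defines "kkt0 \<equiv> kkt_multipliers M \<alpha> \<epsilon>0 f0 (\<lambda>g. u_affinity M u g g1) g0"
    and "kkt1 \<equiv> kkt_multipliers M \<alpha> \<epsilon>1 f1 (\<lambda>g. u_affinity M u g0 g) g1"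
    and "base0 \<equiv> (\<lambda>lam0 mu0 x. (1 - \<alpha>) / lam0 * (mu0 - (1 - u) * (g1 x / g0 x) powr u) + 1)"
    and "base1 \<equiv> (\<lambda>lam1 mu1 x. (1 - \<alpha>) / lam1 * (mu1 - u * (g1 x / g0 x) powr (- 1 + u)) + 1)"
  shows "(\<exists>lam0 mu0. kkt0 lam0 mu0) \<and> (\<exists>lam1 mu1. kkt1 lam1 mu1) \<and>
    (\<forall>lam0 mu0 lam1 mu1. kkt0 lam0 mu0 \<and> kkt1 lam1 mu1 \<longrightarrow>
       (lam0 = 0 \<or> lam1 = 0 \<longrightarrow> (AE x in M. g0 x = g1 x)) \<and>
       (lam0 \<noteq> 0 \<longrightarrow>
          (AE x in M. 0 < base0 lam0 mu0 x \<and>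
             g0 x = base0 lam0 mu0 x powr (1 / (\<alpha> - 1)) * f0 x)) \<and>
       (lam1 \<noteq> 0 \<longrightarrow>
          (AE x in M. 0 < base1 lam1 mu1 x \<and>
             g1 x = base1 lam1 mu1 x powr (1 / (\<alpha> - 1)) * f1 x)) \<and>
       (lam0 \<noteq> 0 \<and> lam1 \<noteq> 0 \<longrightarrow>
          (AE x in M. g1 x / g0 x =
             (base1 lam1 mu1 x / base0 lam0 mu0 x) powr (1 / (\<alpha> - 1)) * (f1 x / f0 x))))"
proof -
  have max0: "is_arg_max (\<lambda>g. u_affinity M u g g1) (feasible M \<alpha> \<epsilon>0 f0) g0"
    and max1: "is_arg_max (\<lambda>g. u_affinity M (1 - u) g g0) (feasible M \<alpha> \<epsilon>1 f1) g1"
    using assms(9) by (simp_all add: least_favorable_def u_affinity_swap[of M u g0])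
  then have p: "pos_prob_density M g0" "pos_prob_density M g1"
    by (auto simp: is_arg_max_def feasible_def)
  interpret A0: affinity_constraint M \<alpha> f0 u g1
    by unfold_locales (use assms p in auto)
  interpret A1: affinity_constraint M \<alpha> f1 "1 - u" g0
    by unfold_locales (use assms p in auto)
  have kkt1: "kkt1 = kkt_multipliers M \<alpha> \<epsilon>1 f1 (\<lambda>g. u_affinity M (1 - u) g g0) g1"
    unfolding kkt1_def by (simp add: u_affinity_swap[of M u g0])
  \<comment> \<open>Exchanging the roles inverts the ratio, which flips the sign of the exponent
    \<open>1 - u\<close>.\<close>
  have base1: "AE x in M. (1 - \<alpha>) / lam1 * (mu1 - (1 - (1 - u)) * (g0 x / g1 x) powr (1 - u)) + 1
      = base1 lam1 mu1 x" for lam1 mu1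
    using pos_prob_densityD(3)[OF p(1)] pos_prob_densityD(3)[OF p(2)]
  proof eventually_elim
    case (elim x)
    have "(g0 x / g1 x) powr (1 - u) = (g1 x / g0 x) powr (- (1 - u))"
      using elim powr_minus[of "g1 x / g0 x" "1 - u"] by (simp add: powr_divide)
    then show ?case by (simp add: base1_def)
  qed
  have F0: "AE x in M. 0 < base0 lam0 mu0 x \<and> g0 x = base0 lam0 mu0 x powr (1 / (\<alpha> - 1)) * f0 x"
    if "kkt0 lam0 mu0" "lam0 \<noteq> 0" for lam0 mu0
    using A0.least_favorable_formula that assms(5) unfolding kkt0_def base0_def by simp
  have F1: "AE x in M. 0 < base1 lam1 mu1 x \<and> g1 x = base1 lam1 mu1 x powr (1 / (\<alpha> - 1)) * f1 x"
    if "kkt1 lam1 mu1" "lam1 \<noteq> 0" for lam1 mu1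
    using A1.least_favorable_formula[OF that(1)[unfolded kkt1] _ that(2)] base1[of lam1 mu1] assms(6)
    by (auto elim: eventually_elim2)
  have "AE x in M. g1 x / g0 x = (base1 lam1 mu1 x / base0 lam0 mu0 x) powr (1 / (\<alpha> - 1)) * (f1 x / f0 x)"
    if "kkt0 lam0 mu0" "kkt1 lam1 mu1" "lam0 \<noteq> 0" "lam1 \<noteq> 0" for lam0 mu0 lam1 mu1
    using F0[OF that(1,3)] F1[OF that(2,4)]
  proof eventually_elim
    case (elim x)
    then have "g1 x / g0 x =
        (base1 lam1 mu1 x powr (1 / (\<alpha> - 1)) * f1 x) / (base0 lam0 mu0 x powr (1 / (\<alpha> - 1)) * f0 x)"
      by (metis (no_types))
    \<comment> \<open>Positivity of both bases lets the two powers merge into a power of their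
      quotient.\<close>
    also have "\<dots> = (base1 lam1 mu1 x / base0 lam0 mu0 x) powr (1 / (\<alpha> - 1)) * (f1 x / f0 x)"
      using elim by (simp add: powr_divide)
    finally show ?case .
  qed
  moreover have "AE x in M. g0 x = g1 x" if "kkt0 lam0 mu0" "kkt1 lam1 mu1" "lam0 = 0 \<or> lam1 = 0"
    for lam0 mu0 lam1 mu1
    using that A0.zero_multiplier_imp_eq[of \<epsilon>0 g0 mu0] A1.zero_multiplier_imp_eq[of \<epsilon>1 g1 mu1] assms(5,6)
    unfolding kkt0_def kkt1 by (auto elim: eventually_mono)
  moreover have "\<exists>lam0 mu0. kkt0 lam0 mu0"
    unfolding kkt0_def by (rule A0.kkt_multipliers_exist[OF assms(5) max0])
  moreover have "\<exists>lam1 mu1. kkt1 lam1 mu1"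
    unfolding kkt1 by (rule A1.kkt_multipliers_exist[OF assms(6) max1])
  ultimately show ?thesis using F0 F1 by blast
qed

end
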